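(* Let $1<q<\infty$. If $u\in BV_w(\mathbb{R}^N)\cap VMO(\mathbb{R}^N)$, then $$\lim_{h\to0}\int_{\mathbb{R}^N}\frac{|u(x+h)-u(x)|^q}{|h|}\,dx=0 .$$
   Context: $\mathcal{L}^N$ is Lebesgue measure. $[f]_{L^1_w(\mathbb{R}^N)}:=\sup_{t>0}t\,\mathcal{L}^N(\{|f|>t\})$, and $L^1_w(\mathbb{R}^N)$ is the set of measurable $f$ for which it is finite. $u\in BV_w(\mathbb{R}^N)$ means that $u\in L^1_w(\mathbb{R}^N)$ and $$\sup_{h\in\mathbb{R}^N\setminus\{0\}}\frac{[u(\cdot+h)-u]_{L^1_w(\mathbb{R}^N)}}{|h|}<\infty .$$ A cube is a Cartesian product of $N$ non-empty closed bounded intervals of the same (positive) length. For real-valued $u\in L^1_{\mathrm{loc}}(\mathbb{R}^N)$, $u\in BMO(\mathbb{R}^N)$ means that $\sup_C \frac{1}{\mathcal{L}^N(C)^2}\int_C\int_C|u(z)-u(x)|\,dz\,dx<\infty$, the supremum being over all cubes $C\subset\mathbb{R}^N$. $VMO(\mathbb{R}^N)$ is the set of $u\in BMO(\mathbb{R}^N)$ with $$\lim_{R\to0^+}\ \sup_{C\text{ cube},\ \operatorname{diam}(C)\le R}\ \frac{1}{\mathcal{L}^N(C)^2}\int_C\int_C|u(x)-u(z)|\,dx\,dz=0 .$$ *)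

theory Defs
  imports "HOL-Analysis.Analysis"
begin

text \<open>Suprema and integrals of nonnegative quantities are taken in \<^typ>\<open>ennreal\<close>,
  so no finiteness is built in silently; measurability refers to the completed Lebesgue measure.\<close>

definition weak_L1_quasinorm :: "(real^'n \<Rightarrow> real) \<Rightarrow> ennreal" where
  "weak_L1_quasinorm f = (SUP t\<in>{0<..}. ennreal t * emeasure lebesgue {x. \<bar>f x\<bar> > t})"

definition weak_L1 :: "(real^'n \<Rightarrow> real) set" where
  "weak_L1 = {f. f \<in> borel_measurable lebesgue \<and> weak_L1_quasinorm f < \<infinity>}"

definition BV_w :: "(real^'n \<Rightarrow> real) set" where
  "BV_w = {u. u \<in> weak_L1 \<and>
     (SUP h\<in>UNIV - {0}. weak_L1_quasinorm (\<lambda>x. u (x + h) - u x) / ennreal (norm h)) < \<infinity>}"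

definition is_cube :: "(real^'n) set \<Rightarrow> bool" where
  "is_cube C \<longleftrightarrow> (\<exists>a l. 0 < l \<and> C = {x. \<forall>i. x $ i \<in> {a $ i .. a $ i + l}})"

definition L1_loc :: "(real^'n \<Rightarrow> real) set" where
  "L1_loc = {u. u \<in> borel_measurable lebesgue \<and>
     (\<forall>K. compact K \<longrightarrow> set_integrable lebesgue K u)}"

definition mean_oscillation :: "(real^'n \<Rightarrow> real) \<Rightarrow> (real^'n) set \<Rightarrow> ennreal" where
  "mean_oscillation u C =
     (\<integral>\<^sup>+x\<in>C. (\<integral>\<^sup>+z\<in>C. ennreal \<bar>u z - u x\<bar> \<partial>lebesgue) \<partial>lebesgue) / (emeasure lebesgue C)\<^sup>2"

definition BMO :: "(real^'n \<Rightarrow> real) set" where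
  "BMO = {u. u \<in> L1_loc \<and> (SUP C\<in>{C. is_cube C}. mean_oscillation u C) < \<infinity>}"

definition VMO :: "(real^'n \<Rightarrow> real) set" where
  "VMO = {u. u \<in> BMO \<and>
     ((\<lambda>R. SUP C\<in>{C. is_cube C \<and> diameter C \<le> R}. mean_oscillation u C) \<longlongrightarrow> 0) (at_right (0::real))}"

end

theory Submission
  imports Defs "HOL-Real_Asymp.Real_Asymp"
begin

text \<open>
  Put \<open>w x = u (x + h) - u x\<close>. Since \<open>u\<close> is in \<open>BV_w\<close>, the superlevel set \<open>E t = {\<bar>w\<bar> > t}\<close> has
  measure at most \<open>M \<bar>h\<bar> / t\<close>. Fix \<open>\<delta> > 0\<close>. As \<open>u\<close> is in \<open>VMO\<close>, the mean oscillation of \<open>w\<close> is a small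
  multiple of \<open>\<delta>\<close> on all cubes of side at most some \<open>L\<close>. For small \<open>\<bar>h\<bar>\<close> and \<open>t \<ge> \<delta>\<close> the set \<open>E t\<close> has
  small density in every cube of side \<open>L\<close>, so a Calderon-Zygmund stopping argument covers almost all
  of it by disjoint dyadic cubes in which it fills between a fixed proportion and one half. Small
  oscillation on these cubes gives \<open>\<bar>E (t + \<delta>)\<bar> \<le> \<bar>E t\<bar> / 2\<close>, hence exponential decay of
  \<open>\<bar>E (\<delta> (k + 1))\<bar>\<close>. Summing over dyadic layers below \<open>\<delta>\<close> and arithmetic layers above it bounds the
  integral of \<open>\<bar>w\<bar>^q\<close> by \<open>C M \<bar>h\<bar> \<delta>^(q-1)\<close>, and \<open>\<delta>\<close> is arbitrary.
\<close>

section \<open>Cubes and dyadic stopping cells\<close>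

text \<open>Two kinds of cube are kept: half-open ones partition space and serve as dyadic cells,
  while the oscillation conditions are stated on closed ones.\<close>

definition halfopen_cube :: "real^'n \<Rightarrow> real \<Rightarrow> (real^'n) set" where
  "halfopen_cube a l = {y. \<forall>i. a $ i \<le> y $ i \<and> y $ i < a $ i + l}"

definition closed_cube :: "real^'n \<Rightarrow> real \<Rightarrow> (real^'n) set" where
  "closed_cube a l = {y. \<forall>i. y $ i \<in> {a $ i .. a $ i + l}}"

lemma closed_cube_eq_cbox: "closed_cube a l = cbox a (a + vec l)"
  by (auto simp: closed_cube_def mem_box_cart)

lemma halfopen_cube_subset_closed_cube: "halfopen_cube a l \<subseteq> closed_cube a l"
  by (auto simp: halfopen_cube_def closed_cube_def less_imp_le)

lemma emeasure_closed_cube: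
  fixes a :: "real^'n"
  assumes "0 < l"
  shows "emeasure lebesgue (closed_cube a l) = ennreal (l ^ CARD('n))"
proof -
  have ne: "cbox a (a + vec l) \<noteq> {}"
    using assms by (auto simp: interval_ne_empty_cart)
  have "emeasure lebesgue (cbox a (a + vec l)) = ennreal (measure lebesgue (cbox a (a + vec l)))"
    by (simp add: emeasure_eq_ennreal_measure emeasure_lborel_cbox_eq)
  also have "measure lebesgue (cbox a (a + vec l)) = l ^ CARD('n)"
    using content_cbox_cart[OF ne] by simp
  finally show ?thesis by (simp add: closed_cube_eq_cbox)
qed

lemma sets_halfopen_cube [measurable]: "halfopen_cube a l \<in> sets lebesgue"
proof -
  have "halfopen_cube a l = (\<Inter>i. {y. a $ i \<le> y $ i} \<inter> {y. y $ i < a $ i + l})"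
    by (auto simp: halfopen_cube_def)
  also have "\<dots> \<in> sets borel"
    by (intro sets.countable_INT'' sets.Int borel_closed borel_open closed_Collect_le
        open_Collect_less continuous_intros) auto
  finally show ?thesis by simp
qed

text \<open>Sandwiched between the open and the closed box, which have the same measure.\<close>

lemma emeasure_halfopen_cube:
  fixes a :: "real^'n"
  assumes "0 < l"
  shows "emeasure lebesgue (halfopen_cube a l) = ennreal (l ^ CARD('n))"
proof (rule antisym)
  show "emeasure lebesgue (halfopen_cube a l) \<le> ennreal (l ^ CARD('n))"
    unfolding emeasure_closed_cube[OF assms, of a, symmetric]
    by (intro emeasure_mono halfopen_cube_subset_closed_cube) (simp add: closed_cube_eq_cbox)
  have "ennreal (l ^ CARD('n)) = emeasure lebesgue (cbox a (a + vec l))"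
    using emeasure_closed_cube[OF assms, of a] by (simp add: closed_cube_eq_cbox)
  also have "\<dots> = emeasure lebesgue (box a (a + vec l))"
    by (simp add: emeasure_lborel_cbox_eq emeasure_lborel_box_eq)
  also have "\<dots> \<le> emeasure lebesgue (halfopen_cube a l)"
    by (intro emeasure_mono) (auto simp: halfopen_cube_def mem_box_cart less_imp_le)
  finally show "ennreal (l ^ CARD('n)) \<le> emeasure lebesgue (halfopen_cube a l)" .
qed

section \<open>Dyadic grids of side \<open>L / 2 ^ k\<close>\<close>

text \<open>Encoded as the class of all points sharing the floors of \<open>x\<close> at level
  \<open>k\<close>, so that cells with a common point are equal by rewriting, without comparing
  corners.\<close>

definition dyadic_cell :: "real \<Rightarrow> nat \<Rightarrow> real^'n \<Rightarrow> (real^'n) set" where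
  "dyadic_cell L k x = {y. \<forall>i. \<lfloor>2 ^ k * y $ i / L\<rfloor> = \<lfloor>2 ^ k * x $ i / L\<rfloor>}"

lemma dyadic_cell_self [simp]: "x \<in> dyadic_cell L k x"
  by (simp add: dyadic_cell_def)

lemma dyadic_cell_eq: "y \<in> dyadic_cell L k x \<Longrightarrow> dyadic_cell L k y = dyadic_cell L k x"
  by (simp add: dyadic_cell_def)

text \<open>The floor at level \<open>k\<close> is the integer half of the floor at level
  \<open>Suc k\<close>, so the finer floors determine the coarser ones.\<close>

lemma dyadic_cell_Suc_subset: "dyadic_cell L (Suc k) x \<subseteq> dyadic_cell L k x"
proof -
  have "\<lfloor>2 ^ k * r / L\<rfloor> = \<lfloor>2 ^ Suc k * r / L\<rfloor> div 2" for r
    using floor_divide_real_eq_div[of 2 "2 ^ Suc k * r / L"] by (simp add: ac_simps)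
  then show ?thesis
    unfolding dyadic_cell_def by auto
qed

lemma dyadic_cell_antimono: "j \<le> k \<Longrightarrow> dyadic_cell L k x \<subseteq> dyadic_cell L j x"
  by (induction k rule: dec_induct) (use dyadic_cell_Suc_subset in blast)+

lemma dyadic_cell_eq_halfopen_cube:
  assumes "0 < L"
  shows "dyadic_cell L k x = halfopen_cube (\<chi> i. of_int \<lfloor>2 ^ k * x $ i / L\<rfloor> * (L / 2 ^ k)) (L / 2 ^ k)"
proof -
  have "\<lfloor>2 ^ k * r / L\<rfloor> = m \<longleftrightarrow> of_int m * (L / 2 ^ k) \<le> r \<and> r < of_int m * (L / 2 ^ k) + L / 2 ^ k"
    for r and m :: int
    using assms by (simp add: floor_eq_iff field_simps)
  then show ?thesis
    by (auto simp: dyadic_cell_def halfopen_cube_def)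
qed

lemma emeasure_dyadic_cell:
  fixes x :: "real^'n"
  assumes "0 < L"
  shows "emeasure lebesgue (dyadic_cell L k x) = ennreal ((L / 2 ^ k) ^ CARD('n))"
  unfolding dyadic_cell_eq_halfopen_cube[OF assms]
  by (rule emeasure_halfopen_cube) (use assms in simp)

lemma sets_dyadic_cell: "0 < L \<Longrightarrow> dyadic_cell L k x \<in> sets lebesgue"
  by (simp add: dyadic_cell_eq_halfopen_cube)

text \<open>Points of one cell differ by at most \<open>L / 2 ^ k\<close> in each coordinate, hence
  by at most \<open>CARD('n)\<close> times that in norm, and this tends to 0.\<close>

lemma dyadic_cell_subset_ball:
  fixes x :: "real^'n"
  assumes "0 < L" "0 < e"
  shows "\<exists>k. dyadic_cell L k x \<subseteq> ball x e"
proof -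
  have "(\<lambda>k. real CARD('n) * L * (1 / 2) ^ k) \<longlonglongrightarrow> real CARD('n) * L * 0"
    by (intro tendsto_intros LIMSEQ_realpow_zero) auto
  then have "eventually (\<lambda>k. real CARD('n) * L * (1 / 2) ^ k < e) sequentially"
    using assms by (intro order_tendstoD(2)[where y = "real CARD('n) * L * 0"]) auto
  then obtain k where k: "real CARD('n) * L * (1 / 2) ^ k < e"
    by (auto simp: eventually_sequentially)
  have "y \<in> ball x e" if y: "y \<in> dyadic_cell L k x" for y
  proof -
    have "\<bar>x $ i - y $ i\<bar> \<le> L / 2 ^ k" for i
    proof -
      have "y \<in> halfopen_cube (\<chi> i. of_int \<lfloor>2 ^ k * x $ i / L\<rfloor> * (L / 2 ^ k)) (L / 2 ^ k)"
        and "x \<in> halfopen_cube (\<chi> i. of_int \<lfloor>2 ^ k * x $ i / L\<rfloor> * (L / 2 ^ k)) (L / 2 ^ k)"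
        using y dyadic_cell_eq_halfopen_cube[OF assms(1)] dyadic_cell_self by blast+
      then show ?thesis
        unfolding halfopen_cube_def by (auto simp: abs_le_iff dest!: spec[of _ i])
    qed
    then have "norm (x - y) \<le> (\<Sum>i\<in>(UNIV :: 'n set). L / 2 ^ k)"
      by (intro order_trans[OF norm_le_l1_cart] sum_mono) simp
    also have "\<dots> < e"
      using k by (simp add: power_one_over field_simps)
    finally show ?thesis by (simp add: dist_norm)
  qed
  then show ?thesis by blast
qed

text \<open>The base points are uncountable, but a cell depends only on its level and on an integer
  vector.\<close>

lemma countable_dyadic_cells: "countable {dyadic_cell L k (x :: real^'n) | k x. True}"
  (is "countable ?S")
proof -
  let ?f = "\<lambda>(k, m). {y :: real^'n. \<forall>i. \<lfloor>2 ^ k * y $ i / L\<rfloor> = (m :: 'n \<Rightarrow> int) i}"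
  have "?S \<subseteq> range ?f"
  proof
    fix Q assume "Q \<in> ?S"
    then obtain k and x :: "real^'n" where "Q = dyadic_cell L k x" by auto
    then have "Q = ?f (k, \<lambda>i. \<lfloor>2 ^ k * x $ i / L\<rfloor>)" by (simp add: dyadic_cell_def)
    then show "Q \<in> range ?f" by (rule range_eqI)
  qed
  then show ?thesis
    by (rule countable_subset) simp
qed

section \<open>Maximal dyadic cells and almost everywhere covering\<close>

text \<open>These are the maximal cells with property \<open>P\<close> among those of side at most
  \<open>L\<close>. Two choices of \<open>P\<close> occur below: high density of a set, and
  inclusion in an open set.\<close>

definition stopping_cells :: "real \<Rightarrow> ((real^'n) set \<Rightarrow> bool) \<Rightarrow> (real^'n) set set" where
  "stopping_cells L P =
     {dyadic_cell L k x | k x. P (dyadic_cell L k x) \<and> (\<forall>j<k. \<not> P (dyadic_cell L j x))}"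

lemma countable_stopping_cells: "countable (stopping_cells L P)"
  by (rule countable_subset[OF _ countable_dyadic_cells[of L]]) (auto simp: stopping_cells_def)

lemma sets_stopping_cells: "0 < L \<Longrightarrow> Q \<in> stopping_cells L P \<Longrightarrow> Q \<in> sets lebesgue"
  by (auto simp: stopping_cells_def sets_dyadic_cell)

lemma Union_stopping_cells: "\<Union> (stopping_cells L P) = {x. \<exists>k. P (dyadic_cell L k x)}"
proof (intro equalityI subsetI)
  fix x assume "x \<in> \<Union> (stopping_cells L P)"
  then show "x \<in> {x. \<exists>k. P (dyadic_cell L k x)}"
    unfolding stopping_cells_def by auto (metis dyadic_cell_eq)
next
  fix x assume "x \<in> {x. \<exists>k. P (dyadic_cell L k x)}"
  then have ex: "\<exists>k. P (dyadic_cell L k x)" by simp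
  define k where "k = (LEAST k. P (dyadic_cell L k x))"
  have "P (dyadic_cell L k x)" "\<forall>j<k. \<not> P (dyadic_cell L j x)"
    unfolding k_def using LeastI_ex[OF ex] not_less_Least by blast+
  then show "x \<in> \<Union> (stopping_cells L P)"
    unfolding stopping_cells_def using dyadic_cell_self by blast
qed

text \<open>Two stopping cells with a common point \<open>y\<close> are both cells around
  \<open>y\<close>, and the first level at which \<open>P\<close> holds around \<open>y\<close> is
  unique.\<close>

lemma disjoint_stopping_cells: "disjoint_family_on (\<lambda>Q. Q) (stopping_cells L P)"
  unfolding disjoint_family_on_def
proof (intro ballI impI)
  fix Q R assume Q: "Q \<in> stopping_cells L P" and R: "R \<in> stopping_cells L P" and ne: "Q \<noteq> R"
  show "Q \<inter> R = {}"
  proof (rule ccontr)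
    assume "Q \<inter> R \<noteq> {}"
    then obtain y where y: "y \<in> Q" "y \<in> R" by auto
    from Q obtain k x where k: "Q = dyadic_cell L k x" "P Q" "\<forall>j<k. \<not> P (dyadic_cell L j x)"
      by (auto simp: stopping_cells_def)
    from R obtain m z where m: "R = dyadic_cell L m z" "P R" "\<forall>j<m. \<not> P (dyadic_cell L j z)"
      by (auto simp: stopping_cells_def)
    have Qy: "Q = dyadic_cell L k y" and Ry: "R = dyadic_cell L m y"
      using dyadic_cell_eq y k(1) m(1) by metis+
    have kx: "dyadic_cell L j x = dyadic_cell L j y" if "j \<le> k" for j
      using dyadic_cell_antimono[OF that, of L x] y(1) k(1) dyadic_cell_eq by blast
    have mz: "dyadic_cell L j z = dyadic_cell L j y" if "j \<le> m" for j
      using dyadic_cell_antimono[OF that, of L z] y(2) m(1) dyadic_cell_eq by blast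
    have "k = m"
    proof (rule antisym; rule ccontr)
      assume "\<not> k \<le> m"
      then show False using k(3)[rule_format, of m] kx[of m] m(2) Ry by simp
    next
      assume "\<not> m \<le> k"
      then show False using m(3)[rule_format, of k] mz[of k] k(2) Qy by simp
    qed
    then show False using ne Qy Ry by simp
  qed
qed

lemma emeasure_Int_Union_stopping_cells:
  assumes "0 < L" "A \<in> sets lebesgue"
  shows "emeasure lebesgue (A \<inter> \<Union> (stopping_cells L P)) =
    (\<integral>\<^sup>+Q. emeasure lebesgue (A \<inter> Q) \<partial>count_space (stopping_cells L P))"
proof -
  have "A \<inter> \<Union> (stopping_cells L P) = (\<Union>Q\<in>stopping_cells L P. A \<inter> Q)" by auto
  moreover have "disjoint_family_on (\<lambda>Q. A \<inter> Q) (stopping_cells L P)"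
    using disjoint_stopping_cells[of L P] unfolding disjoint_family_on_def by blast
  moreover have "A \<inter> Q \<in> sets lebesgue" if "Q \<in> stopping_cells L P" for Q
    using assms sets_stopping_cells[OF assms(1) that] by blast
  ultimately show ?thesis
    using countable_stopping_cells by (metis emeasure_UN_countable)
qed

text \<open>This replaces the Lebesgue density theorem. If the uncovered part \<open>F\<close> had
  positive measure, an open \<open>G\<close> around it with measure below twice that of
  \<open>F\<close> could be cut into maximal dyadic cells. In each of them \<open>F\<close> has
  density at most \<tau> \<le> 1/2, so \<open>F\<close> would fill at most half of
  \<open>G\<close>.\<close>

lemma emeasure_Diff_Union_stopping_cells:
  fixes E :: "(real^'n) set"
  assumes L: "0 < L" and E: "E \<in> lmeasurable" and \<tau>: "0 \<le> \<tau>" "\<tau> \<le> 1 / 2"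
  shows "emeasure lebesgue
    (E - \<Union> (stopping_cells L (\<lambda>Q. ennreal \<tau> * emeasure lebesgue Q < emeasure lebesgue (E \<inter> Q)))) = 0"
    (is "emeasure lebesgue (E - \<Union> ?S) = 0")
proof (rule ccontr)
  define F where "F = E - \<Union> ?S"
  assume "\<not> ?thesis"
  moreover have F: "F \<in> lmeasurable"
    unfolding F_def using E countable_stopping_cells sets_stopping_cells[OF L]
    by (intro fmeasurable.Diff fmeasurable_Diff sets.countable_Union) auto
  ultimately have pos: "measure lebesgue F > 0"
    unfolding F_def[symmetric] using emeasure_eq_measure2[OF F] by (simp add: less_le)
  obtain G where G: "open G" "F \<subseteq> G" "G - F \<in> lmeasurable"
    "emeasure lebesgue (G - F) < ennreal (measure lebesgue F)"
    using sets_lebesgue_outer_open[OF fmeasurableD[OF F] pos] by blast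
  have GF: "G = F \<union> (G - F)" using G(2) by auto
  have Gm: "G \<in> lmeasurable"
    by (subst GF) (intro fmeasurable.Un F G)
  have mG: "measure lebesgue G < 2 * measure lebesgue F"
  proof -
    have "measure lebesgue G = measure lebesgue F + measure lebesgue (G - F)"
      using F G by (subst GF) (intro measure_Un2[THEN trans], auto)
    then show ?thesis
      using G(4) emeasure_eq_measure2[OF G(3)] by (simp add: ennreal_less_iff)
  qed
  let ?T = "stopping_cells L (\<lambda>Q. Q \<subseteq> G)"
  have FT: "F \<subseteq> \<Union> ?T"
  proof
    fix x assume "x \<in> F"
    then obtain e where "0 < e" "ball x e \<subseteq> G"
      using G(1,2) open_contains_ball by blast
    then show "x \<in> \<Union> ?T"
      unfolding Union_stopping_cells using dyadic_cell_subset_ball[OF L] by blast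
  qed
  have FQ: "emeasure lebesgue (F \<inter> Q) \<le> ennreal \<tau> * emeasure lebesgue (G \<inter> Q)" if Q: "Q \<in> ?T" for Q
  proof (cases "F \<inter> Q = {}")
    case False
    then obtain x where x: "x \<in> F" "x \<in> Q" by auto
    from Q obtain k z where k: "Q = dyadic_cell L k z" "Q \<subseteq> G"
      by (auto simp: stopping_cells_def)
    with x have Qx: "Q = dyadic_cell L k x" by (metis dyadic_cell_eq)
    \<comment> \<open>An uncovered point fails the density test at every level, in particular on the
      cell \<open>Q\<close> around it.\<close>
    have "x \<notin> \<Union> ?S" using x(1) by (simp add: F_def)
    then have "emeasure lebesgue (E \<inter> Q) \<le> ennreal \<tau> * emeasure lebesgue Q"
      unfolding Union_stopping_cells Qx by (auto simp: not_less)
    moreover have "emeasure lebesgue (F \<inter> Q) \<le> emeasure lebesgue (E \<inter> Q)"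
      using E sets_stopping_cells[OF L Q] by (intro emeasure_mono) (auto simp: F_def)
    moreover have "G \<inter> Q = Q" using k(2) by auto
    ultimately show ?thesis by simp
  qed simp
  have "emeasure lebesgue F = emeasure lebesgue (F \<inter> \<Union> ?T)"
    using FT by (simp add: Int_absorb2)
  also have "\<dots> = (\<integral>\<^sup>+Q. emeasure lebesgue (F \<inter> Q) \<partial>count_space ?T)"
    using L F by (intro emeasure_Int_Union_stopping_cells) auto
  also have "\<dots> \<le> (\<integral>\<^sup>+Q. ennreal \<tau> * emeasure lebesgue (G \<inter> Q) \<partial>count_space ?T)"
    using FQ by (intro nn_integral_mono) simp
  also have "\<dots> = ennreal \<tau> * emeasure lebesgue (G \<inter> \<Union> ?T)"
    using L Gm by (subst emeasure_Int_Union_stopping_cells) (auto simp: nn_integral_cmult)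
  also have "\<dots> \<le> ennreal \<tau> * emeasure lebesgue G"
    using Gm by (intro mult_left_mono emeasure_mono) auto
  finally have "measure lebesgue F \<le> \<tau> * measure lebesgue G"
    using F Gm \<tau> by (simp add: emeasure_eq_measure2 ennreal_mult[symmetric] del: emeasure_completion)
  also have "\<dots> \<le> 1 / 2 * measure lebesgue G"
    using \<tau> by (intro mult_right_mono) auto
  finally show False using mG by simp
qed

text \<open>The threshold \<open>1 / 2 ^ Suc CARD('n)\<close> is tuned to the step from parent to
  child: the parent cell failed the test and has \<open>2 ^ CARD('n)\<close> times the volume, so
  \<open>E\<close> has density at most 1/2 in the child.\<close>

lemma stopping_cell_cube:
  fixes E :: "(real^'n) set"
  assumes L: "0 < L" and E: "E \<in> lmeasurable"
    and small: "measure lebesgue E \<le> L ^ CARD('n) / 2 ^ Suc CARD('n)"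
    and Q: "Q \<in> stopping_cells L
      (\<lambda>Q. ennreal (1 / 2 ^ Suc CARD('n)) * emeasure lebesgue Q < emeasure lebesgue (E \<inter> Q))"
  obtains a l where "Q = halfopen_cube a l" "0 < l" "l \<le> L" "measure lebesgue (E \<inter> Q) \<le> l ^ CARD('n) / 2"
proof -
  let ?n = "CARD('n)"
  have EQ: "E \<inter> dyadic_cell L k x \<in> lmeasurable" for k x
    using E sets_dyadic_cell[OF L] by (intro fmeasurable.Int fmeasurable_Int_fmeasurable) auto
  have P: "(ennreal (1 / 2 ^ Suc ?n) * emeasure lebesgue (dyadic_cell L k x)
       < emeasure lebesgue (E \<inter> dyadic_cell L k x))
     \<longleftrightarrow> (L / 2 ^ k) ^ ?n / 2 ^ Suc ?n < measure lebesgue (E \<inter> dyadic_cell L k x)" for k x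
    using L by (simp add: emeasure_dyadic_cell emeasure_eq_measure2[OF EQ] ennreal_mult[symmetric]
        ennreal_less_iff del: emeasure_completion)
  from Q obtain k x where k: "Q = dyadic_cell L k x"
    "(L / 2 ^ k) ^ ?n / 2 ^ Suc ?n < measure lebesgue (E \<inter> Q)"
    "\<forall>j<k. \<not> (L / 2 ^ j) ^ ?n / 2 ^ Suc ?n < measure lebesgue (E \<inter> dyadic_cell L j x)"
    unfolding stopping_cells_def mem_Collect_eq P by blast
  \<comment> \<open>The smallness of \<open>E\<close> makes every cell of side \<open>L\<close> fail
    the test, so a stopping cell always has a parent in the grid.\<close>
  have "k \<noteq> 0"
  proof
    assume "k = 0"
    then have "L ^ ?n / 2 ^ Suc ?n < measure lebesgue (E \<inter> Q)" using k(2) by simp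
    also have "\<dots> \<le> measure lebesgue E"
      using E EQ k(1) by (intro measure_mono_fmeasurable) auto
    finally show False using small by simp
  qed
  then obtain j where j: "k = Suc j" by (metis not0_implies_Suc)
  have "measure lebesgue (E \<inter> Q) \<le> measure lebesgue (E \<inter> dyadic_cell L j x)"
    using EQ dyadic_cell_Suc_subset[of L j x] k(1) j by (intro measure_mono_fmeasurable) auto
  also have "\<dots> \<le> (L / 2 ^ j) ^ ?n / 2 ^ Suc ?n"
    using k(3) j by (simp add: not_less)
  also have "\<dots> = (L / 2 ^ k) ^ ?n / 2"
    by (simp add: j power_divide power_mult_distrib field_simps)
  finally have "measure lebesgue (E \<inter> Q) \<le> (L / 2 ^ k) ^ ?n / 2" .
  moreover have "0 < L / 2 ^ k" "L / 2 ^ k \<le> L" using L by (auto simp: field_simps)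
  ultimately show thesis
    using that k(1) dyadic_cell_eq_halfopen_cube[OF L] by blast
qed

section \<open>Oscillation and translation\<close>

lemma measurable_lebesgue_shift [measurable]:
  "(\<lambda>x :: 'a::euclidean_space. x + h) \<in> lebesgue \<rightarrow>\<^sub>M lebesgue"
  using lebesgue_affine_measurable[of "\<lambda>_. 1" h]
  by (simp add: euclidean_representation add.commute)

lemma nn_integral_lebesgue_shift:
  fixes f :: "'a::euclidean_space \<Rightarrow> ennreal"
  assumes "f \<in> borel_measurable lebesgue"
  shows "(\<integral>\<^sup>+x. f (x + h) \<partial>lebesgue) = (\<integral>\<^sup>+x. f x \<partial>lebesgue)"
proof -
  \<comment> \<open>A translation is the affine map with all scale factors 1, so the density in the
    change of variables is 1.\<close>
  have "lebesgue = distr lebesgue lebesgue (\<lambda>x. x + h)"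
    using lebesgue_affine_euclidean[of "\<lambda>_. 1" h]
    by (simp add: euclidean_representation add.commute density_1)
  then have "(\<integral>\<^sup>+x. f x \<partial>lebesgue) = (\<integral>\<^sup>+x. f x \<partial>distr lebesgue lebesgue (\<lambda>x. x + h))"
    by (rule arg_cong)
  also have "\<dots> = (\<integral>\<^sup>+x. f (x + h) \<partial>lebesgue)"
    using assms by (intro nn_integral_distr) measurable
  finally show ?thesis ..
qed

text \<open>Replacing \<open>u\<close> by an almost everywhere equal Borel function makes the
  integrand jointly Borel in \<open>z\<close> and \<open>c\<close>. The real parameter
  \<open>c\<close> stands for \<open>u x\<close>; composing with \<open>u\<close> yields
  measurability of the inner oscillation integral in \<open>x\<close>.\<close>

lemma borel_measurable_nn_integral_dist:
  fixes u :: "'a::euclidean_space \<Rightarrow> real"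
  assumes u: "u \<in> borel_measurable lebesgue" and C [measurable]: "C \<in> sets borel"
  shows "(\<lambda>c. \<integral>\<^sup>+z\<in>C. ennreal \<bar>u z - c\<bar> \<partial>lebesgue) \<in> borel_measurable borel"
proof -
  obtain v where v [measurable]: "v \<in> borel_measurable lborel" and "AE x in lborel. u x = v x"
    using completion_ex_borel_measurable_real[OF u] by blast
  then have "(\<integral>\<^sup>+z\<in>C. ennreal \<bar>u z - c\<bar> \<partial>lebesgue) = (\<integral>\<^sup>+z\<in>C. ennreal \<bar>v z - c\<bar> \<partial>lborel)" for c
    unfolding nn_integral_completion by (intro nn_integral_cong_AE) auto
  then show ?thesis by simp
qed

section \<open>Oscillation over cubes\<close>

text \<open>The numerator of \<open>mean_oscillation\<close>, separated so that subadditivity and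
  translation need no division in \<open>ennreal\<close>.\<close>

definition oscillation_integral :: "(real^'n \<Rightarrow> real) \<Rightarrow> (real^'n) set \<Rightarrow> ennreal" where
  "oscillation_integral u C = (\<integral>\<^sup>+x\<in>C. (\<integral>\<^sup>+z\<in>C. ennreal \<bar>u z - u x\<bar> \<partial>lebesgue) \<partial>lebesgue)"

lemma oscillation_integral_diff_le:
  fixes u v :: "real^'n \<Rightarrow> real"
  assumes u [measurable]: "u \<in> borel_measurable lebesgue" and v [measurable]: "v \<in> borel_measurable lebesgue"
    and C: "C \<in> sets borel"
  shows "oscillation_integral (\<lambda>x. v x - u x) C \<le> oscillation_integral v C + oscillation_integral u C"
proof -
  have C' [measurable]: "C \<in> sets lebesgue" using C by simp
  have meas: "(\<lambda>x. (\<integral>\<^sup>+z\<in>C. ennreal \<bar>f z - f x\<bar> \<partial>lebesgue) * indicator C x) \<in> borel_measurable lebesgue"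
    if "f \<in> borel_measurable lebesgue" for f :: "real^'n \<Rightarrow> real"
    using measurable_compose[OF that borel_measurable_nn_integral_dist[OF that C]] C'
    by (intro borel_measurable_times_ennreal) auto
  have "oscillation_integral (\<lambda>x. v x - u x) C
    \<le> (\<integral>\<^sup>+x. (\<integral>\<^sup>+z\<in>C. ennreal \<bar>v z - v x\<bar> \<partial>lebesgue) * indicator C x
           + (\<integral>\<^sup>+z\<in>C. ennreal \<bar>u z - u x\<bar> \<partial>lebesgue) * indicator C x \<partial>lebesgue)"
    unfolding oscillation_integral_def
  proof (rule nn_integral_mono)
    fix x
    have "(\<integral>\<^sup>+z\<in>C. ennreal \<bar>v z - u z - (v x - u x)\<bar> \<partial>lebesgue)
       \<le> (\<integral>\<^sup>+z. ennreal \<bar>v z - v x\<bar> * indicator C z + ennreal \<bar>u z - u x\<bar> * indicator C z \<partial>lebesgue)"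
      by (intro nn_integral_mono)
         (auto simp: indicator_def ennreal_plus[symmetric] simp del: ennreal_plus intro!: ennreal_leI)
    also have "\<dots> = (\<integral>\<^sup>+z\<in>C. ennreal \<bar>v z - v x\<bar> \<partial>lebesgue) + (\<integral>\<^sup>+z\<in>C. ennreal \<bar>u z - u x\<bar> \<partial>lebesgue)"
      by (intro nn_integral_add) measurable
    finally show "(\<integral>\<^sup>+z\<in>C. ennreal \<bar>v z - u z - (v x - u x)\<bar> \<partial>lebesgue) * indicator C x
      \<le> (\<integral>\<^sup>+z\<in>C. ennreal \<bar>v z - v x\<bar> \<partial>lebesgue) * indicator C x
           + (\<integral>\<^sup>+z\<in>C. ennreal \<bar>u z - u x\<bar> \<partial>lebesgue) * indicator C x"
      by (auto simp: indicator_def)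
  qed
  also have "\<dots> = oscillation_integral v C + oscillation_integral u C"
    unfolding oscillation_integral_def by (intro nn_integral_add meas u v)
  finally show ?thesis .
qed

lemma borel_closed_cube: "closed_cube a l \<in> sets borel"
  by (simp add: closed_cube_eq_cbox)

lemma oscillation_integral_shift:
  fixes u :: "real^'n \<Rightarrow> real"
  assumes u [measurable]: "u \<in> borel_measurable lebesgue"
  shows "oscillation_integral (\<lambda>x. u (x + h)) (closed_cube a l) = oscillation_integral u (closed_cube (a + h) l)"
proof -
  have C [measurable]: "closed_cube (a + h) l \<in> sets lebesgue"
    by (simp add: closed_cube_eq_cbox)
  have ind: "indicator (closed_cube a l) z = (indicator (closed_cube (a + h) l) (z + h) :: ennreal)" for z
    by (auto simp: indicator_def closed_cube_def algebra_simps)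
  \<comment> \<open>With \<open>u (x + h)\<close> generalised to a constant \<open>c\<close>, the
    inner change of variables can be made before the outer one.\<close>
  have inner: "(\<integral>\<^sup>+z\<in>closed_cube a l. ennreal \<bar>u (z + h) - c\<bar> \<partial>lebesgue)
      = (\<integral>\<^sup>+z\<in>closed_cube (a + h) l. ennreal \<bar>u z - c\<bar> \<partial>lebesgue)" for c
    unfolding ind
    by (rule nn_integral_lebesgue_shift[of "\<lambda>z. ennreal \<bar>u z - c\<bar> * indicator (closed_cube (a + h) l) z"])
       measurable
  show ?thesis
    unfolding oscillation_integral_def inner unfolding ind
    using measurable_compose[OF u borel_measurable_nn_integral_dist[OF u borel_closed_cube]]
    by (intro nn_integral_lebesgue_shift[of "\<lambda>x. (\<integral>\<^sup>+z\<in>closed_cube (a + h) l. ennreal \<bar>u z - u x\<bar> \<partial>lebesgue)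
          * indicator (closed_cube (a + h) l) x"] borel_measurable_times_ennreal) auto
qed

lemma ennreal_le_mult_of_divide_le:
  assumes "a / ennreal b \<le> ennreal c" "0 < b" "0 \<le> c"
  shows "a \<le> ennreal (c * b)"
proof -
  have "a = a / ennreal b * ennreal b"
    using assms by (simp add: ennreal_divide_times ennreal_divide_self)
  also have "\<dots> \<le> ennreal c * ennreal b"
    using assms by (intro mult_right_mono) auto
  also have "\<dots> = ennreal (c * b)"
    using assms by (simp add: ennreal_mult)
  finally show ?thesis .
qed

lemma oscillation_integral_le:
  fixes u :: "real^'n \<Rightarrow> real"
  assumes "mean_oscillation u (closed_cube a l) \<le> ennreal \<eta>" "0 < l" "0 \<le> \<eta>"
  shows "oscillation_integral u (closed_cube a l) \<le> ennreal (\<eta> * (l ^ CARD('n))\<^sup>2)"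
proof (rule ennreal_le_mult_of_divide_le)
  show "oscillation_integral u (closed_cube a l) / ennreal ((l ^ CARD('n))\<^sup>2) \<le> ennreal \<eta>"
    using assms unfolding mean_oscillation_def oscillation_integral_def emeasure_closed_cube[OF assms(2)]
    by (simp add: ennreal_power)
qed (use assms in auto)

lemma diameter_closed_cube_le:
  fixes a :: "real^'n" and l :: real
  assumes "0 < l"
  shows "diameter (closed_cube a l) \<le> CARD('n) * l"
proof (rule diameter_le)
  fix x y assume "x \<in> closed_cube a l" "y \<in> closed_cube a l"
  then have "\<bar>(x - y) $ i\<bar> \<le> l" for i
    unfolding closed_cube_def by (auto simp: abs_le_iff dest!: spec[of _ i])
  then have "norm (x - y) \<le> (\<Sum>i\<in>(UNIV :: 'n set). l)"
    by (intro order_trans[OF norm_le_l1_cart] sum_mono)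
  then show "norm (x - y) \<le> CARD('n) * l" by simp
qed (use assms in auto)

lemma VMO_small_oscillation:
  fixes u :: "real^'n \<Rightarrow> real"
  assumes "u \<in> VMO" "0 < \<eta>"
  obtains L where "0 < L"
    "\<And>a l. 0 < l \<Longrightarrow> l \<le> L \<Longrightarrow> oscillation_integral u (closed_cube a l) \<le> ennreal (\<eta> * (l ^ CARD('n))\<^sup>2)"
proof -
  have "((\<lambda>R. SUP C\<in>{C. is_cube C \<and> diameter C \<le> R}. mean_oscillation u C) \<longlongrightarrow> 0) (at_right (0::real))"
    using assms by (simp add: VMO_def)
  then have "eventually (\<lambda>R. (SUP C\<in>{C. is_cube C \<and> diameter C \<le> R}. mean_oscillation u C) < ennreal \<eta>) (at_right 0)"
    using assms by (intro order_tendstoD(2)) auto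
  then obtain b :: real where "0 < b"
    and b: "\<And>R. 0 < R \<Longrightarrow> R < b \<Longrightarrow> (SUP C\<in>{C. is_cube C \<and> diameter C \<le> R}. mean_oscillation u C) < ennreal \<eta>"
    by (auto simp: eventually_at_right_field)
  \<comment> \<open>Dividing by \<open>CARD('n)\<close> passes from diameter to side; the factor 1/2
    keeps the diameter bound strictly below \<open>b\<close>.\<close>
  define L where "L = b / 2 / CARD('n)"
  show thesis
  proof
    show "0 < L" using \<open>0 < b\<close> by (simp add: L_def)
    fix a :: "real^'n" and l :: real assume l: "0 < l" "l \<le> L"
    have "diameter (closed_cube a l) \<le> CARD('n) * L"
      using diameter_closed_cube_le[OF l(1), of a] l(2)
      by (meson mult_left_mono of_nat_0_le_iff order_trans)
    then have "diameter (closed_cube a l) \<le> b / 2" by (simp add: L_def)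
    moreover have "is_cube (closed_cube a l)"
      using l unfolding is_cube_def closed_cube_def by blast
    ultimately have "mean_oscillation u (closed_cube a l)
        \<le> (SUP C\<in>{C. is_cube C \<and> diameter C \<le> b / 2}. mean_oscillation u C)"
      by (intro SUP_upper) auto
    also have "\<dots> \<le> ennreal \<eta>"
      using b[of "b / 2"] \<open>0 < b\<close> by (auto intro: less_imp_le)
    finally show "oscillation_integral u (closed_cube a l) \<le> ennreal (\<eta> * (l ^ CARD('n))\<^sup>2)"
      using l assms by (intro oscillation_integral_le) auto
  qed
qed

text \<open>\<open>M\<close> is the finite supremum in \<open>BV_w\<close> itself. The bound is
  linear in \<open>norm h\<close>, which later cancels the denominator of the difference
  quotient.\<close>

lemma BV_w_superlevel_bound:
  fixes u :: "real^'n \<Rightarrow> real"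
  assumes "u \<in> BV_w"
  obtains M where "0 \<le> M"
    "\<And>h t. h \<noteq> 0 \<Longrightarrow> 0 < t \<Longrightarrow>
      emeasure lebesgue {x. \<bar>u (x + h) - u x\<bar> > t} \<le> ennreal (M * norm h / t)"
proof -
  define S where "S = (SUP h\<in>UNIV - {0}. weak_L1_quasinorm (\<lambda>x. u (x + h) - u x) / ennreal (norm h))"
  have "S < \<infinity>" using assms by (simp add: BV_w_def S_def)
  then obtain M where M: "0 \<le> M" "S = ennreal M" by (cases S) auto
  show thesis
  proof
    show "0 \<le> M" by fact
    fix h :: "real^'n" and t :: real assume h: "h \<noteq> 0" and t: "0 < t"
    let ?w = "\<lambda>x. u (x + h) - u x"
    have "weak_L1_quasinorm ?w / ennreal (norm h) \<le> ennreal M"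
      unfolding M(2)[symmetric] S_def using h by (intro SUP_upper2[of h]) auto
    then have q: "weak_L1_quasinorm ?w \<le> ennreal (M * norm h)"
      using h M by (intro ennreal_le_mult_of_divide_le) auto
    have "ennreal t * emeasure lebesgue {x. \<bar>?w x\<bar> > t} \<le> weak_L1_quasinorm ?w"
      unfolding weak_L1_quasinorm_def using t by (intro SUP_upper) auto
    also note q
    finally have le: "ennreal t * emeasure lebesgue {x. \<bar>?w x\<bar> > t} \<le> ennreal (M * norm h)" .
    have "emeasure lebesgue {x. \<bar>?w x\<bar> > t}
        = ennreal (1 / t) * (ennreal t * emeasure lebesgue {x. \<bar>?w x\<bar> > t})"
      using t by (simp add: mult.assoc[symmetric] ennreal_mult[symmetric] del: emeasure_completion)
    also have "\<dots> \<le> ennreal (1 / t) * ennreal (M * norm h)"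
      using le by (rule mult_left_mono) simp
    also have "\<dots> = ennreal (M * norm h / t)"
      using t M by (simp add: ennreal_mult[symmetric])
    finally show "emeasure lebesgue {x. \<bar>?w x\<bar> > t} \<le> ennreal (M * norm h / t)" .
  qed
qed

section \<open>Decay of superlevel sets\<close>

lemma sets_superlevel:
  fixes w :: "'a::euclidean_space \<Rightarrow> real"
  assumes [measurable]: "w \<in> borel_measurable lebesgue"
  shows "{x. \<bar>w x\<bar> > t} \<in> sets lebesgue"
proof -
  have "{x \<in> space lebesgue. \<bar>w x\<bar> > t} \<in> sets lebesgue" by measurable
  then show ?thesis by simp
qed

text \<open>On a stopping cube at most half of the points satisfy \<open>\<bar>w\<bar> > t\<close>; comparing the remaining
  points with those where \<open>\<bar>w\<bar> > t + s\<close> bounds the measure of the latter by the oscillation of \<open>w\<close>.\<close>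

lemma good_lambda:
  fixes w :: "real^'n \<Rightarrow> real"
  assumes w [measurable]: "w \<in> borel_measurable lebesgue"
    and L: "0 < L" and s: "0 < s" and \<kappa>: "0 \<le> \<kappa>"
    and osc: "\<And>a l. 0 < l \<Longrightarrow> l \<le> L \<Longrightarrow>
      oscillation_integral w (closed_cube a l) \<le> ennreal (\<kappa> * (l ^ CARD('n))\<^sup>2)"
    and fin: "{x. \<bar>w x\<bar> > t} \<in> lmeasurable"
    and small: "measure lebesgue {x. \<bar>w x\<bar> > t} \<le> L ^ CARD('n) / 2 ^ Suc CARD('n)"
  shows "s * measure lebesgue {x. \<bar>w x\<bar> > t + s}
    \<le> 2 ^ (CARD('n) + 2) * \<kappa> * measure lebesgue {x. \<bar>w x\<bar> > t}"
proof -
  let ?n = "CARD('n)"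
  define E where "E = {x. \<bar>w x\<bar> > t}"
  define A where "A = {x. \<bar>w x\<bar> > t + s}"
  let ?S = "stopping_cells L
      (\<lambda>Q. ennreal (1 / 2 ^ Suc ?n) * emeasure lebesgue Q < emeasure lebesgue (E \<inter> Q))"
  have E: "E \<in> lmeasurable" using fin by (simp add: E_def)
  have AE: "A \<subseteq> E" using s by (auto simp: A_def E_def)
  have As: "A \<in> sets lebesgue"
    unfolding A_def by (rule sets_superlevel[OF w])
  have A: "A \<in> lmeasurable"
    using fmeasurableI2[OF E AE As] .
  have cell: "ennreal s * emeasure lebesgue (A \<inter> Q)
      \<le> ennreal (2 ^ (?n + 2) * \<kappa>) * emeasure lebesgue (E \<inter> Q)" if Q: "Q \<in> ?S" for Q
  proof -
    obtain a l where Ql: "Q = halfopen_cube a l" "0 < l" "l \<le> L" "measure lebesgue (E \<inter> Q) \<le> l ^ ?n / 2"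
      using stopping_cell_cube[OF L E _ Q] small unfolding E_def by blast
    have Qs: "Q \<in> sets lebesgue" by (rule sets_stopping_cells[OF L Q])
    have eQ: "emeasure lebesgue Q = ennreal (l ^ ?n)"
      unfolding Ql(1) by (rule emeasure_halfopen_cube[OF Ql(2)])
    have Qm: "Q \<in> lmeasurable" using eQ Qs by (intro fmeasurableI) auto
    have mQ: "measure lebesgue Q = l ^ ?n" using eQ Ql(2) by (simp add: measure_def)
    have m: "A \<inter> Q \<in> lmeasurable" "E \<inter> Q \<in> lmeasurable" "Q - E \<in> lmeasurable"
      using A E Qm Qs by (auto intro: fmeasurable.Int fmeasurable.Diff)
    have "measure lebesgue (Q - E) = measure lebesgue Q - measure lebesgue (E \<inter> Q)"
      using measurable_measure_Diff[of Q lebesgue "E \<inter> Q"] Qm m(2)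
      by (metis Diff_Int_distrib2 Diff_Int2 Int_lower2 Diff_Int Diff_cancel Un_empty_right fmeasurableD)
    then have half: "l ^ ?n / 2 \<le> measure lebesgue (Q - E)" using Ql(4) mQ by simp
    \<comment> \<open>For \<open>x\<close> in \<open>A \<inter> Q\<close> and \<open>z\<close> in
      \<open>Q - E\<close> the values satisfy \<open>\<bar>w x\<bar> > t + s\<close> and
      \<open>\<bar>w z\<bar> \<le> t\<close>, so they differ by at least \<open>s\<close>; this
      product set contributes to the oscillation over the closed cube.\<close>
    have "ennreal (s * measure lebesgue (Q - E) * measure lebesgue (A \<inter> Q))
       = (\<integral>\<^sup>+x\<in>A \<inter> Q. (\<integral>\<^sup>+z\<in>Q - E. ennreal s \<partial>lebesgue) \<partial>lebesgue)"
      using m s by (simp add: nn_integral_cmult_indicator emeasure_eq_measure2 ennreal_mult fmeasurableD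
          del: emeasure_completion)
    also have "\<dots> \<le> oscillation_integral w (closed_cube a l)"
      unfolding oscillation_integral_def
    proof (rule nn_integral_mono)
      fix x
      have "(\<integral>\<^sup>+z\<in>Q - E. ennreal s \<partial>lebesgue) \<le> (\<integral>\<^sup>+z\<in>closed_cube a l. ennreal \<bar>w z - w x\<bar> \<partial>lebesgue)"
        if "x \<in> A \<inter> Q"
        using that halfopen_cube_subset_closed_cube[of a l] unfolding Ql(1) A_def E_def
        by (intro nn_integral_mono) (auto simp: indicator_def intro!: ennreal_leI)
      then show "(\<integral>\<^sup>+z\<in>Q - E. ennreal s \<partial>lebesgue) * indicator (A \<inter> Q) x
        \<le> (\<integral>\<^sup>+z\<in>closed_cube a l. ennreal \<bar>w z - w x\<bar> \<partial>lebesgue) * indicator (closed_cube a l) x"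
        using halfopen_cube_subset_closed_cube[of a l] unfolding Ql(1)
        by (auto simp: indicator_def)
    qed
    also have "\<dots> \<le> ennreal (\<kappa> * (l ^ ?n)\<^sup>2)" by (rule osc[OF Ql(2,3)])
    finally have *: "s * measure lebesgue (Q - E) * measure lebesgue (A \<inter> Q) \<le> \<kappa> * (l ^ ?n)\<^sup>2"
      using \<kappa> by simp
    have "s * (l ^ ?n / 2) * measure lebesgue (A \<inter> Q) \<le> s * measure lebesgue (Q - E) * measure lebesgue (A \<inter> Q)"
      using half s by (intro mult_right_mono mult_left_mono) auto
    with * have "l ^ ?n * (s * measure lebesgue (A \<inter> Q)) \<le> l ^ ?n * (2 * \<kappa> * l ^ ?n)"
      by (simp add: power2_eq_square algebra_simps)
    then have "s * measure lebesgue (A \<inter> Q) \<le> 2 * \<kappa> * l ^ ?n"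
      using Ql(2) by (simp add: mult_le_cancel_left)
    \<comment> \<open>The stopping condition is read backwards, bounding the volume of
      \<open>Q\<close> by the measure of \<open>E \<inter> Q\<close>. Its factor
      \<open>2 ^ Suc ?n\<close> and the 2 from the half-empty cube make up
      \<open>2 ^ (?n + 2)\<close>.\<close>
    also have "\<dots> \<le> 2 * \<kappa> * (2 ^ Suc ?n * measure lebesgue (E \<inter> Q))"
    proof -
      have "ennreal (1 / 2 ^ Suc ?n) * emeasure lebesgue Q < emeasure lebesgue (E \<inter> Q)"
        using Q by (auto simp: stopping_cells_def)
      then have "1 / 2 ^ Suc ?n * l ^ ?n < measure lebesgue (E \<inter> Q)"
        using Ql(2) by (simp add: eQ emeasure_eq_measure2[OF m(2)] ennreal_mult[symmetric] ennreal_less_iff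
            del: emeasure_completion)
      then have "l ^ ?n \<le> 2 ^ Suc ?n * measure lebesgue (E \<inter> Q)"
        by (simp add: pos_divide_less_eq mult.commute)
      then show ?thesis using \<kappa> by (intro mult_left_mono) auto
    qed
    also have "\<dots> = 2 ^ (?n + 2) * \<kappa> * measure lebesgue (E \<inter> Q)"
      by simp
    finally have "s * measure lebesgue (A \<inter> Q) \<le> 2 ^ (?n + 2) * \<kappa> * measure lebesgue (E \<inter> Q)" .
    then show ?thesis
      using s \<kappa> by (simp add: emeasure_eq_measure2[OF m(1)] emeasure_eq_measure2[OF m(2)] ennreal_mult[symmetric]
          del: emeasure_completion)
  qed
  have US: "\<Union> ?S \<in> sets lebesgue"
    using countable_stopping_cells sets_stopping_cells[OF L] by (intro sets.countable_Union) auto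
  \<comment> \<open>Only a null part of \<open>E\<close>, hence of \<open>A\<close>, escapes the
    cells, so the local estimates may be summed.\<close>
  have "emeasure lebesgue (E - \<Union> ?S) = 0"
    using L E by (intro emeasure_Diff_Union_stopping_cells) (auto simp: field_simps)
  then have "E - \<Union> ?S \<in> null_sets lebesgue" using E US by auto
  moreover have "A - \<Union> ?S \<in> sets lebesgue" using As US by (rule sets.Diff)
  moreover have "A - \<Union> ?S \<subseteq> E - \<Union> ?S" using AE by (rule Diff_mono) simp
  ultimately have null: "A - \<Union> ?S \<in> null_sets lebesgue"
    by (rule null_sets_subset)
  have "emeasure lebesgue ((A \<inter> \<Union> ?S) \<union> (A - \<Union> ?S)) = emeasure lebesgue (A \<inter> \<Union> ?S)"
    using As US by (intro emeasure_Un_null_set null sets.Int)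
  then have "emeasure lebesgue A = emeasure lebesgue (A \<inter> \<Union> ?S)"
    unfolding Int_Diff_Un .
  also have "\<dots> = (\<integral>\<^sup>+Q. emeasure lebesgue (A \<inter> Q) \<partial>count_space ?S)"
    by (rule emeasure_Int_Union_stopping_cells[OF L As])
  finally have "ennreal s * emeasure lebesgue A
      = ennreal s * (\<integral>\<^sup>+Q. emeasure lebesgue (A \<inter> Q) \<partial>count_space ?S)"
    by (rule arg_cong)
  also have "\<dots> = (\<integral>\<^sup>+Q. ennreal s * emeasure lebesgue (A \<inter> Q) \<partial>count_space ?S)"
    by (intro nn_integral_cmult[symmetric]) simp
  also have "\<dots> \<le> (\<integral>\<^sup>+Q. ennreal (2 ^ (?n + 2) * \<kappa>) * emeasure lebesgue (E \<inter> Q) \<partial>count_space ?S)"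
    using cell by (intro nn_integral_mono) simp
  also have "\<dots> = ennreal (2 ^ (?n + 2) * \<kappa>) * emeasure lebesgue (E \<inter> \<Union> ?S)"
    using L E by (subst emeasure_Int_Union_stopping_cells) (auto simp: nn_integral_cmult)
  also have "\<dots> \<le> ennreal (2 ^ (?n + 2) * \<kappa>) * emeasure lebesgue E"
    using E by (intro mult_left_mono emeasure_mono) auto
  finally show ?thesis
    unfolding A_def[symmetric] E_def[symmetric] using A E s \<kappa>
    by (simp add: emeasure_eq_measure2 ennreal_mult[symmetric] del: emeasure_completion)
qed

text \<open>Iteration of \<open>good_lambda\<close> with step \<delta>. The oscillation constant
  \<open>\<delta> / 2 ^ (CARD('n) + 3)\<close> is chosen so that each step halves the measure; the
  smallness hypothesis persists because the sets only shrink.\<close>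

lemma superlevel_decay:
  fixes w :: "real^'n \<Rightarrow> real"
  assumes w: "w \<in> borel_measurable lebesgue" and L: "0 < L" and \<delta>: "0 < \<delta>"
    and osc: "\<And>a l. 0 < l \<Longrightarrow> l \<le> L \<Longrightarrow>
      oscillation_integral w (closed_cube a l) \<le> ennreal (\<delta> / 2 ^ (CARD('n) + 3) * (l ^ CARD('n))\<^sup>2)"
    and fin: "{x. \<bar>w x\<bar> > \<delta>} \<in> lmeasurable"
    and small: "measure lebesgue {x. \<bar>w x\<bar> > \<delta>} \<le> L ^ CARD('n) / 2 ^ Suc CARD('n)"
  shows "{x. \<bar>w x\<bar> > \<delta> * (real k + 1)} \<in> lmeasurable \<and>
    measure lebesgue {x. \<bar>w x\<bar> > \<delta> * (real k + 1)} \<le> measure lebesgue {x. \<bar>w x\<bar> > \<delta>} / 2 ^ k"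
proof (induction k)
  case 0
  then show ?case using fin by simp
next
  case (Suc k)
  let ?t = "\<delta> * (real k + 1)"
  have t: "\<delta> * (real (Suc k) + 1) = ?t + \<delta>" by (simp add: algebra_simps)
  have small': "measure lebesgue {x. \<bar>w x\<bar> > ?t} \<le> L ^ CARD('n) / 2 ^ Suc CARD('n)"
  proof -
    have "measure lebesgue {x. \<bar>w x\<bar> > \<delta>} / 2 ^ k \<le> measure lebesgue {x. \<bar>w x\<bar> > \<delta>}"
      using divide_left_mono[of 1 "2 ^ k :: real" "measure lebesgue {x. \<bar>w x\<bar> > \<delta>}"] by simp
    then show ?thesis using Suc small by linarith
  qed
  have "\<delta> * measure lebesgue {x. \<bar>w x\<bar> > ?t + \<delta>}
      \<le> 2 ^ (CARD('n) + 2) * (\<delta> / 2 ^ (CARD('n) + 3)) * measure lebesgue {x. \<bar>w x\<bar> > ?t}"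
    using Suc \<delta> by (intro good_lambda[OF w L \<delta> _ osc _ small']) auto
  also have "2 ^ (CARD('n) + 2) * (\<delta> / 2 ^ (CARD('n) + 3)) = \<delta> / 2"
    by (simp add: power_add)
  finally have "measure lebesgue {x. \<bar>w x\<bar> > ?t + \<delta>} \<le> measure lebesgue {x. \<bar>w x\<bar> > ?t} / 2"
    using \<delta> by (simp add: field_simps)
  also have "\<dots> \<le> measure lebesgue {x. \<bar>w x\<bar> > \<delta>} / 2 ^ Suc k"
    using Suc by (simp add: field_simps)
  finally have "measure lebesgue {x. \<bar>w x\<bar> > ?t + \<delta>} \<le> measure lebesgue {x. \<bar>w x\<bar> > \<delta>} / 2 ^ Suc k" .
  moreover have "{x. \<bar>w x\<bar> > ?t + \<delta>} \<in> lmeasurable"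
  proof (rule fmeasurableI2)
    show "{x. \<bar>w x\<bar> > ?t} \<in> lmeasurable" using Suc by blast
    show "{x. \<bar>w x\<bar> > ?t + \<delta>} \<subseteq> {x. \<bar>w x\<bar> > ?t}"
      by (rule Collect_mono) (use \<delta> in linarith)
  qed (rule sets_superlevel[OF w])
  ultimately show ?case unfolding t by blast
qed

section \<open>Layer decomposition\<close>

text \<open>A positive \<open>r\<close> lies in one shell,
  \<open>(\<delta> / 2 ^ Suc j, \<delta> / 2 ^ j]\<close> if \<open>r \<le> \<delta>\<close> and
  \<open>(\<delta> * (k + 1), \<delta> * (k + 2)]\<close> otherwise, and that single term dominates.
  Dyadic shells suit the weak bound near 0, arithmetic ones the decay in steps of \<delta>.\<close>

lemma powr_le_layers:
  fixes r \<delta> q :: real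
  assumes r: "0 \<le> r" and \<delta>: "0 < \<delta>" and q: "0 < q"
  shows "ennreal (r powr q) \<le>
    (\<Sum>j. ennreal ((\<delta> / 2 ^ j) powr q) * indicator {\<delta> / 2 ^ Suc j <..} r) +
    (\<Sum>k. ennreal ((\<delta> * (real k + 2)) powr q) * indicator {\<delta> * (real k + 1) <..} r)"
    (is "_ \<le> (\<Sum>j. ?f j) + (\<Sum>k. ?g k)")
proof -
  have term_le: "F i \<le> (\<Sum>j. F j)" for F :: "nat \<Rightarrow> ennreal" and i
    using sum_le_suminf[of F "{i}"] by simp
  consider "r = 0" | "0 < r" "r \<le> \<delta>" | "\<delta> < r" using r by linarith
  then show ?thesis
  proof cases
    case 1
    then show ?thesis by simp
  next
    case 2
    have "(\<lambda>j. \<delta> * (1 / 2) ^ Suc j) \<longlonglongrightarrow> \<delta> * 0"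
      by (intro tendsto_intros LIMSEQ_Suc LIMSEQ_realpow_zero) auto
    then have "eventually (\<lambda>j. \<delta> * (1 / 2) ^ Suc j < r) sequentially"
      using 2 by (intro order_tendstoD(2)[where y = "\<delta> * 0"]) auto
    then have "\<exists>j. \<delta> * (1 / 2) ^ Suc j < r"
      by (auto simp: eventually_sequentially)
    then have ex: "\<exists>j. \<delta> / 2 ^ Suc j < r" by (simp add: power_one_over)
    \<comment> \<open>Minimality supplies the upper end of the shell: the test fails at the
      preceding index, and for \<open>j = 0\<close> the case assumption
      \<open>r \<le> \<delta>\<close> takes over.\<close>
    define j where "j = (LEAST j. \<delta> / 2 ^ Suc j < r)"
    have j: "\<delta> / 2 ^ Suc j < r" unfolding j_def by (rule LeastI_ex[OF ex])
    have "r \<le> \<delta> / 2 ^ j"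
    proof (cases j)
      case 0
      then show ?thesis using 2 by simp
    next
      case (Suc i)
      then have "\<not> \<delta> / 2 ^ Suc i < r" by (intro not_less_Least[of i "\<lambda>j. \<delta> / 2 ^ Suc j < r"]) (simp add: j_def)
      then show ?thesis using Suc by simp
    qed
    then have "ennreal (r powr q) \<le> ?f j"
      using j powr_mono2[of q r "\<delta> / 2 ^ j"] r q by (simp add: ennreal_leI)
    also note term_le[of ?f j]
    finally show ?thesis by (rule add_increasing2[rotated]) simp
  next
    case 3
    obtain m :: nat where "r / \<delta> < real m" using reals_Archimedean2 by blast
    then have ex: "\<exists>k. r \<le> \<delta> * (real k + 2)"
      using \<delta> by (intro exI[of _ m]) (simp add: field_simps)
    \<comment> \<open>Here minimality supplies the lower end of the shell; for \<open>k = 0\<close>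
      it is the case assumption \<open>\<delta> < r\<close>.\<close>
    define k where "k = (LEAST k. r \<le> \<delta> * (real k + 2))"
    have k: "r \<le> \<delta> * (real k + 2)" unfolding k_def by (rule LeastI_ex[OF ex])
    have "\<delta> * (real k + 1) < r"
    proof (cases k)
      case 0
      then show ?thesis using 3 by simp
    next
      case (Suc i)
      then have "\<not> r \<le> \<delta> * (real i + 2)" by (intro not_less_Least[of i "\<lambda>k. r \<le> \<delta> * (real k + 2)"]) (simp add: k_def)
      then show ?thesis using Suc by (simp add: algebra_simps)
    qed
    then have "ennreal (r powr q) \<le> ?g k"
      using powr_mono2[of q r "\<delta> * (real k + 2)"] k r q by (simp add: ennreal_leI)
    also note term_le[of ?g k]
    finally show ?thesis by (rule add_increasing[rotated]) simp
  qed
qed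

lemma nn_integral_powr_le_layers:
  fixes w :: "'a::euclidean_space \<Rightarrow> real"
  assumes w [measurable]: "w \<in> borel_measurable lebesgue" and \<delta>: "0 < \<delta>" and q: "0 < q"
  shows "(\<integral>\<^sup>+x. ennreal (\<bar>w x\<bar> powr q) \<partial>lebesgue) \<le>
    (\<Sum>j. ennreal ((\<delta> / 2 ^ j) powr q) * emeasure lebesgue {x. \<bar>w x\<bar> > \<delta> / 2 ^ Suc j}) +
    (\<Sum>k. ennreal ((\<delta> * (real k + 2)) powr q) * emeasure lebesgue {x. \<bar>w x\<bar> > \<delta> * (real k + 1)})"
proof -
  have sl: "{x. \<bar>w x\<bar> > c} \<in> sets lebesgue" for c
    by (rule sets_superlevel[OF w])
  define f g where "f j x = ennreal ((\<delta> / 2 ^ j) powr q) * indicator {x. \<bar>w x\<bar> > \<delta> / 2 ^ Suc j} x"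
    and "g k x = ennreal ((\<delta> * (real k + 2)) powr q) * indicator {x. \<bar>w x\<bar> > \<delta> * (real k + 1)} x"
    for j k :: nat and x
  have f [measurable]: "f j \<in> borel_measurable lebesgue" and g [measurable]: "g k \<in> borel_measurable lebesgue" for j k
    unfolding f_def g_def using sl by (auto intro!: borel_measurable_times_ennreal borel_measurable_indicator)
  have "ennreal (\<bar>w x\<bar> powr q) \<le> (\<Sum>j. f j x) + (\<Sum>k. g k x)" for x
    using powr_le_layers[OF abs_ge_zero \<delta> q, of "w x"] by (simp only: f_def g_def indicator_def greaterThan_iff mem_Collect_eq)
  then have "(\<integral>\<^sup>+x. ennreal (\<bar>w x\<bar> powr q) \<partial>lebesgue) \<le> (\<integral>\<^sup>+x. (\<Sum>j. f j x) + (\<Sum>k. g k x) \<partial>lebesgue)"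
    by (rule nn_integral_mono)
  also have "\<dots> = (\<integral>\<^sup>+x. (\<Sum>j. f j x) \<partial>lebesgue) + (\<integral>\<^sup>+x. (\<Sum>k. g k x) \<partial>lebesgue)"
    by (intro nn_integral_add borel_measurable_suminf_order f g)
  also have "\<dots> = (\<Sum>j. \<integral>\<^sup>+x. f j x \<partial>lebesgue) + (\<Sum>k. \<integral>\<^sup>+x. g k x \<partial>lebesgue)"
    by (simp only: nn_integral_suminf f g)
  finally show ?thesis
    unfolding f_def g_def nn_integral_cmult_indicator[OF sl] .
qed

text \<open>What remains of the two layer sums once \<open>K * \<delta> powr (q - 1)\<close> is
  factored out. The factor 2 arises because the weak bound is taken at the lower end
  \<open>\<delta> / 2 ^ Suc j\<close>; the \<open>2 ^ k\<close> is the decay.\<close>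

definition layer_constant :: "real \<Rightarrow> real" where
  "layer_constant q = (\<Sum>j. 2 * (1 / 2 ^ j) powr (q - 1)) + (\<Sum>k. (real k + 2) powr q / 2 ^ k)"

text \<open>A geometric series whose ratio \<open>(1 / 2) powr (q - 1)\<close> is below 1 because
  \<open>q > 1\<close>.\<close>

lemma summable_small_layers:
  fixes q :: real
  assumes "1 < q"
  shows "summable (\<lambda>j. 2 * (1 / 2 ^ j) powr (q - 1))"
proof -
  have eq: "(1 / 2 ^ j) powr (q - 1) = ((1 / 2) powr (q - 1)) ^ j" for j :: nat
  proof -
    have "1 / 2 ^ j = (1 / 2 :: real) powr real j" by (simp add: powr_realpow power_one_over)
    then show ?thesis by (simp only: powr_powr powr_power mult.commute)
  qed
  have "summable (\<lambda>j. ((1 / 2 :: real) powr (q - 1)) ^ j)"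
  proof (rule summable_geometric)
    have "(1 / 2 :: real) powr (q - 1) < (1 / 2) powr 0"
      using assms by (intro powr_less_mono') auto
    then show "norm ((1 / 2 :: real) powr (q - 1)) < 1" by simp
  qed
  then show ?thesis unfolding eq by (rule summable_mult)
qed

lemma summable_large_layers: "summable (\<lambda>k. (real k + 2) powr q / 2 ^ k)"
proof (rule summable_comparison_test_bigo)
  show "summable (\<lambda>k. norm (1 / real k ^ 2))"
    using inverse_power_summable[of 2, where 'a = real] by (simp add: field_simps)
  show "(\<lambda>k. (real k + 2) powr q / 2 ^ k) \<in> O(\<lambda>k. 1 / real k ^ 2)"
    by real_asymp
qed

lemma layer_constant_nonneg: "0 \<le> layer_constant q" if "1 < q"
  unfolding layer_constant_def
  by (intro add_nonneg_nonneg suminf_nonneg summable_small_layers[OF that] summable_large_layers) auto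

text \<open>The weak bound controls the layers below \<delta>. Above \<delta> it would leave a
  divergent series, so there the exponential decay is used instead.\<close>

lemma nn_integral_powr_le:
  fixes w :: "'a::euclidean_space \<Rightarrow> real"
  assumes w: "w \<in> borel_measurable lebesgue" and \<delta>: "0 < \<delta>" and q: "1 < q" and K: "0 \<le> K"
    and weak: "\<And>t. 0 < t \<Longrightarrow> emeasure lebesgue {x. \<bar>w x\<bar> > t} \<le> ennreal (K / t)"
    and decay: "\<And>k::nat. emeasure lebesgue {x. \<bar>w x\<bar> > \<delta> * (real k + 1)} \<le> ennreal (K / \<delta> / 2 ^ k)"
  shows "(\<integral>\<^sup>+x. ennreal (\<bar>w x\<bar> powr q) \<partial>lebesgue) \<le> ennreal (K * \<delta> powr (q - 1) * layer_constant q)"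
proof -
  define B where "B = K * \<delta> powr (q - 1)"
  have B: "0 \<le> B" using K by (simp add: B_def)
  have "ennreal ((\<delta> / 2 ^ j) powr q) * emeasure lebesgue {x. \<bar>w x\<bar> > \<delta> / 2 ^ Suc j}
      \<le> ennreal (B * (2 * (1 / 2 ^ j) powr (q - 1)))" for j :: nat
  proof -
    have "ennreal ((\<delta> / 2 ^ j) powr q) * emeasure lebesgue {x. \<bar>w x\<bar> > \<delta> / 2 ^ Suc j}
      \<le> ennreal ((\<delta> / 2 ^ j) powr q) * ennreal (K / (\<delta> / 2 ^ Suc j))"
      using \<delta> by (intro mult_left_mono weak) auto
    also have "\<dots> = ennreal ((\<delta> / 2 ^ j) powr q * (K / (\<delta> / 2 ^ Suc j)))"
      using \<delta> K by (intro ennreal_mult[symmetric]) auto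
    \<comment> \<open>One factor \<open>\<delta> / 2 ^ j\<close> is split off to cancel the
      denominator of the weak bound, leaving the exponent \<open>q - 1\<close>.\<close>
    also have "(\<delta> / 2 ^ j) powr q * (K / (\<delta> / 2 ^ Suc j)) = B * (2 * (1 / 2 ^ j) powr (q - 1))"
    proof -
      have "(\<delta> / 2 ^ j) powr q = (\<delta> / 2 ^ j) * (\<delta> / 2 ^ j) powr (q - 1)"
        using powr_mult_base[of "\<delta> / 2 ^ j" "q - 1"] \<delta> by simp
      also have "(\<delta> / 2 ^ j) powr (q - 1) = \<delta> powr (q - 1) * (1 / 2 ^ j) powr (q - 1)"
        using powr_mult[of \<delta> "1 / 2 ^ j" "q - 1"] \<delta> by simp
      finally show ?thesis
        using \<delta> by (simp add: B_def field_simps)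
    qed
    finally show ?thesis .
  qed
  then have "(\<Sum>j. ennreal ((\<delta> / 2 ^ j) powr q) * emeasure lebesgue {x. \<bar>w x\<bar> > \<delta> / 2 ^ Suc j})
      \<le> (\<Sum>j. ennreal (B * (2 * (1 / 2 ^ j) powr (q - 1))))"
    by (intro suminf_le summableI)
  also have "\<dots> = ennreal (\<Sum>j. B * (2 * (1 / 2 ^ j) powr (q - 1)))"
    using B q by (intro suminf_ennreal2 summable_mult summable_small_layers) auto
  also have "(\<Sum>j. B * (2 * (1 / 2 ^ j) powr (q - 1))) = B * (\<Sum>j. 2 * (1 / 2 ^ j) powr (q - 1))"
    using q by (intro suminf_mult summable_small_layers)
  finally have small: "(\<Sum>j. ennreal ((\<delta> / 2 ^ j) powr q) * emeasure lebesgue {x. \<bar>w x\<bar> > \<delta> / 2 ^ Suc j})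
      \<le> ennreal (B * (\<Sum>j. 2 * (1 / 2 ^ j) powr (q - 1)))" .
  have "ennreal ((\<delta> * (real k + 2)) powr q) * emeasure lebesgue {x. \<bar>w x\<bar> > \<delta> * (real k + 1)}
      \<le> ennreal (B * ((real k + 2) powr q / 2 ^ k))" for k :: nat
  proof -
    have "ennreal ((\<delta> * (real k + 2)) powr q) * emeasure lebesgue {x. \<bar>w x\<bar> > \<delta> * (real k + 1)}
      \<le> ennreal ((\<delta> * (real k + 2)) powr q) * ennreal (K / \<delta> / 2 ^ k)"
      by (intro mult_left_mono decay) auto
    also have "\<dots> = ennreal ((\<delta> * (real k + 2)) powr q * (K / \<delta> / 2 ^ k))"
      using \<delta> K by (intro ennreal_mult[symmetric]) auto
    also have "(\<delta> * (real k + 2)) powr q * (K / \<delta> / 2 ^ k) = B * ((real k + 2) powr q / 2 ^ k)"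
    proof -
      have "(\<delta> * (real k + 2)) powr q = \<delta> powr q * (real k + 2) powr q"
        using \<delta> by (simp add: powr_mult)
      also have "\<delta> powr q = \<delta> * \<delta> powr (q - 1)"
        using powr_mult_base[of \<delta> "q - 1"] \<delta> by simp
      finally show ?thesis
        using \<delta> by (simp add: B_def field_simps)
    qed
    finally show ?thesis .
  qed
  then have "(\<Sum>k. ennreal ((\<delta> * (real k + 2)) powr q) * emeasure lebesgue {x. \<bar>w x\<bar> > \<delta> * (real k + 1)})
      \<le> (\<Sum>k. ennreal (B * ((real k + 2) powr q / 2 ^ k)))"
    by (intro suminf_le summableI)
  also have "\<dots> = ennreal (\<Sum>k. B * ((real k + 2) powr q / 2 ^ k))"
    using B by (intro suminf_ennreal2 summable_mult summable_large_layers) auto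
  also have "(\<Sum>k. B * ((real k + 2) powr q / 2 ^ k)) = B * (\<Sum>k. (real k + 2) powr q / 2 ^ k)"
    by (intro suminf_mult summable_large_layers)
  finally have large: "(\<Sum>k. ennreal ((\<delta> * (real k + 2)) powr q) * emeasure lebesgue {x. \<bar>w x\<bar> > \<delta> * (real k + 1)})
      \<le> ennreal (B * (\<Sum>k. (real k + 2) powr q / 2 ^ k))" .
  have nn: "0 \<le> (\<Sum>j. 2 * (1 / 2 ^ j) powr (q - 1))" "0 \<le> (\<Sum>k. (real k + 2) powr q / 2 ^ k)"
    using q by (auto intro!: suminf_nonneg summable_small_layers summable_large_layers)
  have "(\<integral>\<^sup>+x. ennreal (\<bar>w x\<bar> powr q) \<partial>lebesgue)
      \<le> ennreal (B * (\<Sum>j. 2 * (1 / 2 ^ j) powr (q - 1))) + ennreal (B * (\<Sum>k. (real k + 2) powr q / 2 ^ k))"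
    using q by (intro order_trans[OF nn_integral_powr_le_layers[OF w \<delta>]] add_mono small large) auto
  also have "\<dots> = ennreal (B * layer_constant q)"
    using B nn by (subst ennreal_plus[symmetric]) (auto simp: layer_constant_def distrib_left)
  finally show ?thesis by (simp add: B_def)
qed

section \<open>The difference quotient as h tends to 0\<close>

lemma VMO_difference_quotient_bound:
  fixes u :: "real^'n \<Rightarrow> real"
  assumes q: "1 < q" and u: "u \<in> VMO" and M: "0 \<le> M" and \<delta>: "0 < \<delta>"
    and weak: "\<And>h t. h \<noteq> 0 \<Longrightarrow> 0 < t \<Longrightarrow>
      emeasure lebesgue {x. \<bar>u (x + h) - u x\<bar> > t} \<le> ennreal (M * norm h / t)"
  shows "eventually (\<lambda>h. (\<integral>\<^sup>+x. ennreal (\<bar>u (x + h) - u x\<bar> powr q / norm h) \<partial>lebesgue)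
    \<le> ennreal (M * \<delta> powr (q - 1) * layer_constant q)) (at 0)"
proof -
  let ?n = "CARD('n)"
  have um [measurable]: "u \<in> borel_measurable lebesgue"
    using u by (simp add: VMO_def BMO_def L1_loc_def)
  \<comment> \<open>Half of the constant demanded by \<open>superlevel_decay\<close>, since both
    \<open>u\<close> and its translate contribute to the oscillation of \<open>w\<close>.\<close>
  define \<eta> where "\<eta> = \<delta> / 2 ^ (?n + 4)"
  have \<eta>: "0 < \<eta>" using \<delta> by (simp add: \<eta>_def)
  obtain L where L: "0 < L"
    and osc: "\<And>a l. 0 < l \<Longrightarrow> l \<le> L \<Longrightarrow> oscillation_integral u (closed_cube a l) \<le> ennreal (\<eta> * (l ^ ?n)\<^sup>2)"
    using VMO_small_oscillation[OF u \<eta>] by blast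
  \<comment> \<open>Chosen so that \<open>norm h < r\<close> forces
    \<open>M * norm h / \<delta>\<close> below the smallness threshold; \<open>M + 1\<close> avoids
    division by zero when \<open>M = 0\<close>.\<close>
  define r where "r = L ^ ?n / 2 ^ Suc ?n * \<delta> / (M + 1)"
  have r: "0 < r" using L \<delta> M by (simp add: r_def)
  have "(\<integral>\<^sup>+x. ennreal (\<bar>u (x + h) - u x\<bar> powr q / norm h) \<partial>lebesgue)
    \<le> ennreal (M * \<delta> powr (q - 1) * layer_constant q)" if h: "h \<noteq> 0" "norm h < r" for h :: "real^'n"
  proof -
    define w where "w = (\<lambda>x. u (x + h) - u x)"
    have shift: "(\<lambda>x. u (x + h)) \<in> borel_measurable lebesgue" by measurable
    have w: "w \<in> borel_measurable lebesgue" unfolding w_def by measurable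
    have oscw: "oscillation_integral w (closed_cube a l) \<le> ennreal (\<delta> / 2 ^ (?n + 3) * (l ^ ?n)\<^sup>2)"
      if l: "0 < l" "l \<le> L" for a l
    proof -
      have "oscillation_integral w (closed_cube a l)
        \<le> oscillation_integral u (closed_cube (a + h) l) + oscillation_integral u (closed_cube a l)"
        using oscillation_integral_diff_le[OF um shift borel_closed_cube, of a l]
        unfolding w_def oscillation_integral_shift[OF um] .
      also have "\<dots> \<le> ennreal (\<eta> * (l ^ ?n)\<^sup>2) + ennreal (\<eta> * (l ^ ?n)\<^sup>2)"
        by (intro add_mono osc l)
      also have "\<dots> = ennreal (\<delta> / 2 ^ (?n + 3) * (l ^ ?n)\<^sup>2)"
      proof -
        have "\<eta> * (l ^ ?n)\<^sup>2 + \<eta> * (l ^ ?n)\<^sup>2 = \<delta> / 2 ^ (?n + 3) * (l ^ ?n)\<^sup>2"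
          by (simp add: \<eta>_def power_add field_simps)
        moreover have "0 \<le> \<eta> * (l ^ ?n)\<^sup>2" using \<eta> by simp
        ultimately show ?thesis by (metis ennreal_plus)
      qed
      finally show ?thesis .
    qed
    have weakw: "emeasure lebesgue {x. \<bar>w x\<bar> > t} \<le> ennreal (M * norm h / t)" if "0 < t" for t
      unfolding w_def by (rule weak[OF h(1) that])
    have fin: "{x. \<bar>w x\<bar> > \<delta>} \<in> lmeasurable"
      using weakw[OF \<delta>] sets_superlevel[OF w] by (intro fmeasurableI) (auto simp: le_less_trans)
    have m: "measure lebesgue {x. \<bar>w x\<bar> > \<delta>} \<le> M * norm h / \<delta>"
      using weakw[OF \<delta>] \<delta> M by (simp add: emeasure_eq_measure2[OF fin] del: emeasure_completion)
    have "M * norm h \<le> (M + 1) * r"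
      using M h(2) by (intro mult_mono) auto
    also have "\<dots> = L ^ ?n / 2 ^ Suc ?n * \<delta>"
      using M by (simp add: r_def)
    finally have "M * norm h / \<delta> \<le> L ^ ?n / 2 ^ Suc ?n"
      using \<delta> by (simp add: field_simps)
    with m have small: "measure lebesgue {x. \<bar>w x\<bar> > \<delta>} \<le> L ^ ?n / 2 ^ Suc ?n" by linarith
    have "emeasure lebesgue {x. \<bar>w x\<bar> > \<delta> * (real k + 1)} \<le> ennreal (M * norm h / \<delta> / 2 ^ k)" for k :: nat
    proof -
      note * = superlevel_decay[OF w L \<delta> oscw fin small, of k]
      have "measure lebesgue {x. \<bar>w x\<bar> > \<delta> * (real k + 1)} \<le> measure lebesgue {x. \<bar>w x\<bar> > \<delta>} / 2 ^ k"
        using * by blast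
      also have "\<dots> \<le> M * norm h / \<delta> / 2 ^ k"
        using m by (intro divide_right_mono) auto
      finally show ?thesis
        using emeasure_eq_measure2[OF conjunct1[OF *]] by (metis ennreal_leI)
    qed
    then have "(\<integral>\<^sup>+x. ennreal (\<bar>w x\<bar> powr q) \<partial>lebesgue)
      \<le> ennreal (M * norm h * \<delta> powr (q - 1) * layer_constant q)"
      using M by (intro nn_integral_powr_le[OF w \<delta> q _ weakw]) auto
    moreover have "(\<integral>\<^sup>+x. ennreal (\<bar>w x\<bar> powr q / norm h) \<partial>lebesgue)
       = (\<integral>\<^sup>+x. ennreal (1 / norm h) * ennreal (\<bar>w x\<bar> powr q) \<partial>lebesgue)"
      by (simp add: ennreal_mult[symmetric])
    moreover have "\<dots> = ennreal (1 / norm h) * (\<integral>\<^sup>+x. ennreal (\<bar>w x\<bar> powr q) \<partial>lebesgue)"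
      using w by (intro nn_integral_cmult) measurable
    ultimately have "(\<integral>\<^sup>+x. ennreal (\<bar>w x\<bar> powr q / norm h) \<partial>lebesgue)
       \<le> ennreal (1 / norm h) * ennreal (M * norm h * \<delta> powr (q - 1) * layer_constant q)"
      by (simp add: mult_left_mono)
    also have "\<dots> = ennreal (M * \<delta> powr (q - 1) * layer_constant q)"
      using h M layer_constant_nonneg[OF q] by (simp add: ennreal_mult[symmetric])
    finally show ?thesis by (simp add: w_def)
  qed
  then show ?thesis
    unfolding eventually_at using r by (intro exI[of _ r]) (auto simp: dist_norm)
qed

theorem theorem1p18:
  fixes u :: "real^'n \<Rightarrow> real" and q :: real
  assumes "1 < q"
    and "u \<in> BV_w \<inter> VMO"
  shows "((\<lambda>h. \<integral>\<^sup>+x. ennreal (\<bar>u (x + h) - u x\<bar> powr q / norm h) \<partial>lebesgue) \<longlongrightarrow> 0) (at 0)"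
proof (rule order_tendstoI)
  fix c :: ennreal assume "0 < c"
  \<comment> \<open>The intermediate \<open>y\<close> is finite even if \<open>c\<close> is
    infinite, which provides a real \<open>e\<close>.\<close>
  then obtain y where y: "0 < y" "y < c" using dense by blast
  then obtain e where e: "0 < e" "ennreal e < c"
    by (cases y) auto
  obtain M where M: "0 \<le> M" "\<And>h t. h \<noteq> 0 \<Longrightarrow> 0 < t \<Longrightarrow>
      emeasure lebesgue {x. \<bar>u (x + h) - u x\<bar> > t} \<le> ennreal (M * norm h / t)"
    using BV_w_superlevel_bound[of u] assms(2) by blast
  \<comment> \<open>The summand 1 keeps \<open>K\<close> positive even when the product
    vanishes.\<close>
  define K where "K = M * layer_constant q + 1"
  have K: "0 < K" "M * layer_constant q \<le> K"
    using M layer_constant_nonneg[OF assms(1)] by (auto simp: K_def add_nonneg_pos)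
  \<comment> \<open>The solution of \<open>K * \<delta> powr (q - 1) = e\<close>, so that the
    eventual bound is at most \<open>e\<close>, strictly below \<open>c\<close>.\<close>
  define \<delta> where "\<delta> = (e / K) powr (1 / (q - 1))"
  have \<delta>: "0 < \<delta>" using e K by (simp add: \<delta>_def)
  have "\<delta> powr (q - 1) = e / K"
    using assms(1) e K by (simp add: \<delta>_def powr_powr)
  then have "M * \<delta> powr (q - 1) * layer_constant q = (M * layer_constant q) * (e / K)" by simp
  also have "\<dots> \<le> K * (e / K)"
    using K e by (intro mult_right_mono) auto
  also have "\<dots> = e" using K by simp
  finally have less: "ennreal (M * \<delta> powr (q - 1) * layer_constant q) < c"
    using e(2) ennreal_leI le_less_trans by blast
  have "eventually (\<lambda>h. (\<integral>\<^sup>+x. ennreal (\<bar>u (x + h) - u x\<bar> powr q / norm h) \<partial>lebesgue)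
      \<le> ennreal (M * \<delta> powr (q - 1) * layer_constant q)) (at 0)"
    using assms(2) M(2)
    by (intro VMO_difference_quotient_bound[OF assms(1) _ M(1) \<delta>]) auto
  then show "eventually (\<lambda>h. (\<integral>\<^sup>+x. ennreal (\<bar>u (x + h) - u x\<bar> powr q / norm h) \<partial>lebesgue) < c) (at 0)"
    by (rule eventually_mono) (rule le_less_trans[OF _ less])
qed simp

end
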